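(* Let $X$ be a real Banach space and $F$ a Banach lattice. Let $(T_n)$ be a sequence of limitedly L-weakly compact operators from $X$ to $F$ that converges in operator norm to a bounded linear operator $T:X\to F$. Then $T$ is limitedly L-weakly compact.
   Context: For a subset $A$ of a Banach lattice, $\mathrm{sol}(A)=\bigcup_{a\in A}[-|a|,|a|]$. A subset $A$ of a Banach lattice is an Lwc set (L-weakly compact set) if every disjoint sequence in $\mathrm{sol}(A)$ converges to $0$ in norm. A bounded subset $A$ of a Banach space $X$ is limited if every weak$^\ast$-null sequence $(f_n)$ in the dual $X'$ satisfies $\sup_{a\in A}|f_n(a)|\to 0$. A bounded linear operator $T:X\to F$ is limitedly L-weakly compact (l-Lwc) if it maps limited subsets of $X$ to Lwc subsets of $F$. *)

theory Defs
  imports "HOL-Analysis.Analysis" "HOL-Library.Lattice_Algebras"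
begin

text \<open>
  A real Banach lattice: a Banach space that is a vector lattice, with
  \<open>\<bar>x\<bar> = sup x (- x)\<close> (from \<^class>\<open>lattice_ab_group_add_abs\<close>) and a lattice norm.
\<close>

class banach_lattice = banach + ordered_real_vector + lattice_ab_group_add_abs +
  assumes norm_mono_abs: "\<bar>x\<bar> \<le> \<bar>y\<bar> \<Longrightarrow> norm x \<le> norm y"

definition sol :: "'a::banach_lattice set \<Rightarrow> 'a set" where
  "sol A = (\<Union>a\<in>A. {- \<bar>a\<bar>..\<bar>a\<bar>})"

definition disjoint_seq :: "(nat \<Rightarrow> 'a::banach_lattice) \<Rightarrow> bool" where
  "disjoint_seq x \<longleftrightarrow> (\<forall>m n. m \<noteq> n \<longrightarrow> inf \<bar>x m\<bar> \<bar>x n\<bar> = 0)"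

definition Lwc_set :: "'a::banach_lattice set \<Rightarrow> bool" where
  "Lwc_set A \<longleftrightarrow> (\<forall>x. range x \<subseteq> sol A \<and> disjoint_seq x \<longrightarrow> (\<lambda>n. norm (x n)) \<longlonglongrightarrow> 0)"

definition weak_star_null :: "(nat \<Rightarrow> 'a::real_normed_vector \<Rightarrow>\<^sub>L real) \<Rightarrow> bool" where
  "weak_star_null f \<longleftrightarrow> (\<forall>x. (\<lambda>n. blinfun_apply (f n) x) \<longlonglongrightarrow> 0)"

text \<open>
  The supremum is taken in \<^typ>\<open>ennreal\<close>, where the supremum over the empty set is \<open>0\<close>;
  on \<^typ>\<open>real\<close> it would be an unspecified value.
\<close>

definition limited_set :: "'a::banach set \<Rightarrow> bool" where
  "limited_set A \<longleftrightarrow> bounded A \<and>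
     (\<forall>f :: nat \<Rightarrow> 'a \<Rightarrow>\<^sub>L real. weak_star_null f \<longrightarrow>
        (\<lambda>n. SUP a\<in>A. ennreal \<bar>blinfun_apply (f n) a\<bar>) \<longlonglongrightarrow> 0)"

definition limitedly_Lwc :: "('a::banach \<Rightarrow>\<^sub>L 'b::banach_lattice) \<Rightarrow> bool" where
  "limitedly_Lwc T \<longleftrightarrow> (\<forall>A. limited_set A \<longrightarrow> Lwc_set (blinfun_apply T ` A))"

end

theory Submission
  imports Defs
begin

text \<open>
  The L-weakly compact sets are closed under uniform approximation: if \<open>\<bar>x\<bar> \<le> \<bar>a\<bar>\<close> and \<open>b\<close> is close
  to \<open>a\<close>, then \<open>inf \<bar>x\<bar> \<bar>b\<bar>\<close> differs from \<open>\<bar>x\<bar>\<close> by at most \<open>\<bar>a - b\<bar>\<close>. Replacing \<open>x\<close> by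
  \<open>inf \<bar>x\<bar> \<bar>b\<bar>\<close> preserves disjointness. Since limited sets are bounded, \<open>S\<close> is uniformly approximated
  on each of them by the \<open>T n\<close>.
\<close>

lemma norm_abs_eq: "norm \<bar>x\<bar> = norm (x::'a::banach_lattice)"
  by (intro antisym norm_mono_abs) simp_all

lemma mem_sol_iff: "x \<in> sol A \<longleftrightarrow> (\<exists>a\<in>A. \<bar>x\<bar> \<le> \<bar>a\<bar>)"
  by (auto simp: sol_def abs_le_iff minus_le_iff)

lemma norm_le_norm_inf_abs_add:
  fixes x a b :: "'a::banach_lattice"
  assumes "\<bar>x\<bar> \<le> \<bar>a\<bar>"
  shows "norm x \<le> norm (inf \<bar>x\<bar> \<bar>b\<bar>) + norm (a - b)"
proof -
  have "\<bar>x\<bar> \<le> \<bar>b\<bar> + \<bar>a - b\<bar>"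
    using assms abs_triangle_ineq[of b "a - b"] by simp
  \<comment> \<open>Translation by \<open>\<bar>a - b\<bar>\<close> commutes with
    \<open>inf\<close>, so the right-hand side is the infimum of
    \<open>\<bar>x\<bar> + \<bar>a - b\<bar>\<close> and
    \<open>\<bar>b\<bar> + \<bar>a - b\<bar>\<close>, both of which dominate
    \<open>\<bar>x\<bar>\<close>.\<close>
  then have "\<bar>x\<bar> \<le> inf \<bar>x\<bar> \<bar>b\<bar> + \<bar>a - b\<bar>"
    by (simp add: add_inf_distrib_right)
  then have "\<bar>x\<bar> - inf \<bar>x\<bar> \<bar>b\<bar> \<le> \<bar>a - b\<bar>"
    by (simp only: diff_le_eq add.commute)
  \<comment> \<open>\<open>norm_mono_abs\<close> compares absolute values, so the difference must
    first be recognised as its own absolute value.\<close>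
  moreover have "\<bar>\<bar>x\<bar> - inf \<bar>x\<bar> \<bar>b\<bar>\<bar> = \<bar>x\<bar> - inf \<bar>x\<bar> \<bar>b\<bar>"
    by (simp only: abs_of_nonneg diff_ge_0_iff_ge inf_le1)
  ultimately have "norm (\<bar>x\<bar> - inf \<bar>x\<bar> \<bar>b\<bar>) \<le> norm (a - b)"
    by (intro norm_mono_abs) (simp only:)
  then show ?thesis
    using norm_triangle_sub[of "\<bar>x\<bar>" "inf \<bar>x\<bar> \<bar>b\<bar>"] by (simp add: norm_abs_eq)
qed

lemma disjoint_seq_mono:
  assumes "disjoint_seq x" and "\<And>n. \<bar>y n\<bar> \<le> \<bar>x n\<bar>"
  shows "disjoint_seq y"
  unfolding disjoint_seq_def
proof (intro allI impI antisym)
  fix m n :: nat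
  assume "m \<noteq> n"
  then have "inf \<bar>x m\<bar> \<bar>x n\<bar> = 0"
    using assms(1) by (simp add: disjoint_seq_def)
  then show "inf \<bar>y m\<bar> \<bar>y n\<bar> \<le> 0"
    using inf_mono[OF assms(2)[of m] assms(2)[of n]] by simp
qed simp

text \<open>Moving the terms of a disjoint sequence from \<open>sol A\<close> into
  \<open>sol B\<close> costs less than \<open>e / 2\<close> in norm, uniformly in the index; the
  tail of the moved sequence contributes the other half. Hence \<open>B\<close> may depend on
  \<open>e\<close>.\<close>

lemma Lwc_set_approx:
  fixes A :: "'a::banach_lattice set"
  assumes "\<And>e. e > 0 \<Longrightarrow> \<exists>B. Lwc_set B \<and> (\<forall>a\<in>A. \<exists>b\<in>B. norm (a - b) < e)"
  shows "Lwc_set A"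
  unfolding Lwc_set_def
proof (intro allI impI, elim conjE)
  fix x :: "nat \<Rightarrow> 'a"
  assume x: "range x \<subseteq> sol A" and disj: "disjoint_seq x"
  show "(\<lambda>n. norm (x n)) \<longlonglongrightarrow> 0"
  proof (rule LIMSEQ_I)
    fix e :: real
    assume "e > 0"
    then obtain B where B: "Lwc_set B" and AB: "\<And>a. a \<in> A \<Longrightarrow> \<exists>b\<in>B. norm (a - b) < e / 2"
      using assms[of "e / 2"] by auto
    have "\<exists>a\<in>A. \<bar>x n\<bar> \<le> \<bar>a\<bar>" for n
      using x mem_sol_iff by blast
    with AB have "\<exists>a b. \<bar>x n\<bar> \<le> \<bar>a\<bar> \<and> b \<in> B \<and> norm (a - b) < e / 2" for n
      by meson
    then obtain a b where ab: "\<And>n. \<bar>x n\<bar> \<le> \<bar>a n\<bar>" "\<And>n. b n \<in> B" "\<And>n. norm (a n - b n) < e / 2"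
      by metis
    \<comment> \<open>The \<open>b n\<close> themselves need not be disjoint. The bound by
      \<open>\<bar>x n\<bar>\<close> makes \<open>y\<close> disjoint, the bound by
      \<open>\<bar>b n\<bar>\<close> puts it into \<open>sol B\<close>.\<close>
    define y where "y n = inf \<bar>x n\<bar> \<bar>b n\<bar>" for n
    have abs_y: "\<bar>y n\<bar> = y n" for n
      by (simp add: y_def)
    have "disjoint_seq y"
      using disj by (rule disjoint_seq_mono) (simp only: abs_y, simp add: y_def)
    moreover have "y n \<in> sol B" for n
      unfolding mem_sol_iff abs_y using ab(2) by (intro bexI[of _ "b n"]) (auto simp: y_def)
    ultimately have "(\<lambda>n. norm (y n)) \<longlonglongrightarrow> 0"
      using B by (auto simp: Lwc_set_def)
    then obtain N where N: "\<And>n. n \<ge> N \<Longrightarrow> norm (y n) < e / 2"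
      using LIMSEQ_D[of _ 0 "e / 2"] \<open>e > 0\<close> by fastforce
    have "norm (x n) < e" if "n \<ge> N" for n
      using norm_le_norm_inf_abs_add[OF ab(1)[of n], of "b n"] N[OF that] ab(3)[of n]
      by (simp add: y_def)
    then show "\<exists>N. \<forall>n\<ge>N. norm (norm (x n) - 0) < e"
      by auto
  qed
qed

theorem proposition2p17:
  fixes T :: "nat \<Rightarrow> 'x::banach \<Rightarrow>\<^sub>L 'f::banach_lattice"
    and S :: "'x \<Rightarrow>\<^sub>L 'f"
  assumes "\<And>n. limitedly_Lwc (T n)"
    and "(\<lambda>n. norm (T n - S)) \<longlonglongrightarrow> 0"
  shows "limitedly_Lwc S"
  unfolding limitedly_Lwc_def
proof (intro allI impI Lwc_set_approx)
  fix A :: "'x set" and e :: real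
  assume A: "limited_set A" and "e > 0"
  \<comment> \<open>Strict positivity keeps \<open>e / M\<close> a positive tolerance even if
    \<open>A\<close> is empty or contains only zero.\<close>
  then obtain M where M: "M > 0" "\<And>a. a \<in> A \<Longrightarrow> norm a \<le> M"
    unfolding limited_set_def bounded_pos by blast
  \<comment> \<open>As \<open>M\<close> bounds all of \<open>A\<close>, one index \<open>n\<close>
    serves every \<open>a\<close>, and the image of \<open>A\<close> under this \<open>T n\<close>
    is the approximating set.\<close>
  then obtain n where n: "norm (T n - S) < e / M"
    using LIMSEQ_D[OF assms(2), of "e / M"] \<open>e > 0\<close> by fastforce
  have "norm (blinfun_apply S a - blinfun_apply (T n) a) < e" if "a \<in> A" for a
  proof -
    have "norm (blinfun_apply S a - blinfun_apply (T n) a) \<le> norm (T n - S) * norm a"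
      using norm_blinfun[of "T n - S" a] by (simp add: blinfun.diff_left norm_minus_commute)
    also have "\<dots> \<le> norm (T n - S) * M"
      using M(2)[OF that] by (intro mult_left_mono) simp_all
    also have "\<dots> < e"
      using n M(1) by (simp add: pos_less_divide_eq)
    finally show ?thesis .
  qed
  moreover have "Lwc_set (blinfun_apply (T n) ` A)"
    using assms(1) A by (simp add: limitedly_Lwc_def)
  ultimately show "\<exists>B. Lwc_set B \<and> (\<forall>a\<in>blinfun_apply S ` A. \<exists>b\<in>B. norm (a - b) < e)"
    by blast
qed

end
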